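(* Let $\tau>0$, let $(\lambda(\tau),u(x,\tau))=\left(\frac{2\tau^2}{\cosh^2\tau},\,2\log\frac{\cosh\tau}{\cosh(\tau x)}\right)$, let $\{\mu_j\}_{j=1}^{\infty}$, $\mu_1<\mu_2<\cdots$, be the eigenvalues (depending on $\tau$) of the problem $$\varphi''+\lambda(\tau)e^{u(x,\tau)}\varphi=-\mu\varphi\ \ (-1<x<1),\qquad \varphi(-1)=\varphi(1)=0,$$ and let $\varphi_j$ be the eigenfunction corresponding to $\mu_j$ (unique up to a nonzero constant multiple). Let $\tau_1$ be the unique solution of $\tau\tanh\tau=1$, $\tau>0$. For $j\ge1$ consider the expression $$(\ast\ast)_j\qquad \varphi_j(x)=\sqrt{\frac{\mu_j}{\tau^2}+\tanh^2(\tau x)}\;\sin\left(\sqrt{\mu_j}\,x+\arctan\left(\frac{\tau\tanh(\tau x)}{\sqrt{\mu_j}}\right)+\frac{\pi}{2}j\right).$$ Then, up to a nonzero constant multiple, the following hold: (i) If $0<\tau<\tau_1$, then for every $j\ge1$, $\varphi_j$ is given by $(\ast\ast)_j$. (ii) If $\tau=\tau_1$, then $$\varphi_1(x)=\tanh\tau_1-x\tanh(\tau_1x),$$ and for every $j\ge 2$, $\varphi_j$ is given by $(\ast\ast)_j$. (iii) If $\tau>\tau_1$, then $$\varphi_1(x)=\sqrt{-\mu_1}\cosh(\sqrt{-\mu_1}\,x)-\tau\sinh(\sqrt{-\mu_1}\,x)\tanh(\tau x),$$ and for every $j\ge2$, $\varphi_j$ is given by $(\ast\ast)_j$.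
   Context: The pairs $(\lambda(\tau),u(\cdot,\tau))$, $\tau>0$, are exactly the positive solutions of the one-dimensional Gel'fand problem $u''+\lambda e^u=0$ on $(-1,1)$, $u(\pm1)=0$, with $\lambda>0$; the eigenvalue problem is its linearization at the solution. Primes denote derivatives in $x$. By classical Sturm–Liouville theory all eigenvalues are real and simple and can be listed as a strictly increasing sequence. The eigenvalues are characterized as follows, so that the expressions in the statement make sense. For $j\ge2$ and all $\tau>0$, and for $j=1$ and $0<\tau<\tau_1$: $\mu_j>0$ and $\tan\left(\sqrt{\mu_j}-\frac{\pi}{2}(j-1)\right)=\frac{\sqrt{\mu_j}}{\tau\tanh\tau}$ with $\frac{\pi}{2}(j-1)<\sqrt{\mu_j}<\frac{\pi}{2}j$. For $\tau=\tau_1$: $\mu_1=0$. For $\tau>\tau_1$: $\mu_1<0$ is the unique negative solution of $\tanh\sqrt{-\mu_1}=\frac{\sqrt{-\mu_1}}{\tau\tanh\tau}$. *)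

theory Defs imports "HOL-Analysis.Analysis" begin

definition gelfand_lambda :: "real \<Rightarrow> real" where
  "gelfand_lambda \<tau> = 2 * \<tau>\<^sup>2 / (cosh \<tau>)\<^sup>2"

definition gelfand_u :: "real \<Rightarrow> real \<Rightarrow> real" where
  "gelfand_u \<tau> x = 2 * ln (cosh \<tau> / cosh (\<tau> * x))"

(* Classical eigenfunctions: twice differentiable inside (-1,1), continuous up to the
   boundary.  Continuity of the second derivative follows from the equation.  Values of
   phi outside [-1,1] are irrelevant. *)
definition is_eigenfunction :: "real \<Rightarrow> real \<Rightarrow> (real \<Rightarrow> real) \<Rightarrow> bool" where
  "is_eigenfunction \<tau> m \<phi> \<longleftrightarrow>
     continuous_on {-1..1} \<phi> \<and>
     (\<forall>x\<in>{-1<..<1}. \<phi> differentiable (at x) \<and> deriv \<phi> differentiable (at x) \<and>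
        deriv (deriv \<phi>) x + gelfand_lambda \<tau> * exp (gelfand_u \<tau> x) * \<phi> x = - m * \<phi> x) \<and>
     \<phi> (-1) = 0 \<and> \<phi> 1 = 0 \<and> (\<exists>x\<in>{-1..1}. \<phi> x \<noteq> 0)"

definition is_eigenvalue :: "real \<Rightarrow> real \<Rightarrow> bool" where
  "is_eigenvalue \<tau> m \<longleftrightarrow> (\<exists>\<phi>. is_eigenfunction \<tau> m \<phi>)"

(* mu 1 < mu 2 < ... lists all eigenvalues; the value mu 0 is irrelevant. *)
definition eigenvalue_sequence :: "real \<Rightarrow> (nat \<Rightarrow> real) \<Rightarrow> bool" where
  "eigenvalue_sequence \<tau> \<mu> \<longleftrightarrow>
     strict_mono_on {1..} \<mu> \<and> \<mu> ` {1..} = {m. is_eigenvalue \<tau> m}"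

definition tau1 :: real where
  "tau1 = (THE t. 0 < t \<and> t * tanh t = 1)"

definition same_up_to_multiple :: "(real \<Rightarrow> real) \<Rightarrow> (real \<Rightarrow> real) \<Rightarrow> bool" where
  "same_up_to_multiple f g \<longleftrightarrow> (\<exists>c. c \<noteq> 0 \<and> (\<forall>x\<in>{-1..1}. f x = c * g x))"

(* Only meaningful for m > 0, because of sqrt m and the division by it. *)
definition sine_form :: "real \<Rightarrow> real \<Rightarrow> nat \<Rightarrow> real \<Rightarrow> real" where
  "sine_form \<tau> m j x =
     sqrt (m / \<tau>\<^sup>2 + (tanh (\<tau> * x))\<^sup>2) *
     sin (sqrt m * x + arctan (\<tau> * tanh (\<tau> * x) / sqrt m) + pi / 2 * real j)"

end

theory Submission imports Defs begin

text \<open>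
The potential is \<open>\<lambda>(\<tau>) exp u = 2 \<tau>^2 / cosh^2 (\<tau> x)\<close>, which is reflectionless: the
first-order operator \<open>A = d/dx - \<tau> tanh (\<tau> x)\<close> satisfies
\<open>A A* = - d^2/dx^2 - 2 \<tau>^2 / cosh^2 (\<tau> x) + \<tau>^2\<close> and \<open>A* A = - d^2/dx^2 + \<tau>^2\<close>, so it maps
solutions of the free equation \<open>y'' = - m y\<close> to solutions of the linearized equation with the same \<open>m\<close>.
The images of the odd and of the even free solution are an even and an odd solution,
\<open>even_sol\<close> and \<open>odd_sol\<close>; their Wronskian is \<open>- (m + \<tau>^2)\<close>.

The positive solution \<open>1 / cosh (\<tau> x)\<close> belonging to \<open>m = - \<tau>^2\<close> does not vanish at the boundary,
which forces every eigenvalue to exceed \<open>- \<tau>^2\<close> (\<open>eigenvalue_lower_bound\<close>).  Hence the two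
solutions are independent whenever \<open>m\<close> is an eigenvalue, every eigenfunction is a combination of them,
and by parity the boundary conditions decouple: an eigenfunction is a multiple of exactly one of
the two, namely of the one that vanishes at \<open>1\<close> (\<open>eigenfunction_cases\<close>).

It remains to see which eigenvalue has which number.  With \<open>a = \<tau> tanh \<tau>\<close> and \<open>m = k^2 > 0\<close>, the
solution \<open>even_sol\<close> or \<open>odd_sol\<close> vanishes at \<open>1\<close> iff the sine or the cosine of
\<open>k - arctan (k / a)\<close> vanishes, that is, iff this phase is a multiple \<open>(j - 1) \<pi> / 2\<close> with \<open>j\<close> odd or
even.  As \<open>arctan t / t\<close> is strictly decreasing, each \<open>j \<ge> 2\<close> gives exactly one \<open>k\<close>, and \<open>j = 1\<close>
gives one iff \<open>a < 1\<close>; if \<open>a \<ge> 1\<close>, the first eigenvalue is \<open>0\<close> (for \<open>a = 1\<close>) or the only negative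
one, because \<open>tanh t / t\<close> is strictly decreasing too.  The \<open>j\<close>-th solution satisfies
\<open>(j - 1) \<pi> / 2 < k < j \<pi> / 2\<close>, so the numbering by \<open>j\<close> is increasing and must agree with the given
sequence (\<open>eigenvalue_sequence_nth\<close>).  Finally, the sine form is the amplitude-phase form of
\<open>even_sol\<close> for odd \<open>j\<close> and of \<open>odd_sol\<close> for even \<open>j\<close>, and \<open>\<tau>\<close> compares to \<open>tau1\<close> as \<open>a\<close> does to \<open>1\<close>.
\<close>

section \<open>The free equation and its Darboux transform\<close>

text \<open>The solutions of \<open>y'' = - m y\<close> with \<open>y 0 = 0\<close>, \<open>y' 0 = 1\<close> and with \<open>y 0 = 1\<close>, \<open>y' 0 = 0\<close>.
Treating the three signs of \<open>m\<close> in one pair of functions lets everything up to the boundary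
values be proved once.\<close>
definition free_sin :: "real \<Rightarrow> real \<Rightarrow> real" where
  "free_sin m x =
     (if m > 0 then sin (sqrt m * x) / sqrt m
      else if m = 0 then x else sinh (sqrt (- m) * x) / sqrt (- m))"

definition free_cos :: "real \<Rightarrow> real \<Rightarrow> real" where
  "free_cos m x =
     (if m > 0 then cos (sqrt m * x)
      else if m = 0 then 1 else cosh (sqrt (- m) * x))"

lemma free_sin_has_derivative: "(free_sin m has_real_derivative free_cos m x) (at x)"
proof -
  have "((\<lambda>x. sin (s * x) / s) has_real_derivative cos (s * x)) (at x)"
    "((\<lambda>x. sinh (s * x) / s) has_real_derivative cosh (s * x)) (at x)" if "s \<noteq> 0" for s
    using that by (auto intro!: derivative_eq_intros)
  from this[of "sqrt \<bar>m\<bar>"] show ?thesis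
    by (cases m "0::real" rule: linorder_cases) (simp_all add: free_sin_def[abs_def] free_cos_def)
qed

lemma free_cos_has_derivative: "(free_cos m has_real_derivative - m * free_sin m x) (at x)"
proof -
  have "((\<lambda>x. cos (s * x)) has_real_derivative - (s * s) * (sin (s * x) / s)) (at x)"
    "((\<lambda>x. cosh (s * x)) has_real_derivative (s * s) * (sinh (s * x) / s)) (at x)" if "s \<noteq> 0" for s
    using that by (auto intro!: derivative_eq_intros)
  from this[of "sqrt \<bar>m\<bar>"] show ?thesis
    by (cases m "0::real" rule: linorder_cases) (simp_all add: free_sin_def free_cos_def[abs_def])
qed

lemma free_pythagoras: "(free_cos m x)\<^sup>2 + m * (free_sin m x)\<^sup>2 = 1"
proof -
  consider "m > 0" | "m = 0" | "m < 0" by linarith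
  then show ?thesis
    by cases (auto simp: free_sin_def free_cos_def power_divide cosh_square_eq)
qed

lemma free_minus [simp]: "free_sin m (- x) = - free_sin m x" "free_cos m (- x) = free_cos m x"
  by (simp_all add: free_sin_def free_cos_def)

lemma free_zero [simp]: "free_sin m 0 = 0" "free_cos m 0 = 1"
  by (simp_all add: free_sin_def free_cos_def)

text \<open>The images of \<open>free_sin\<close> and \<open>free_cos\<close> under \<open>A = d/dx - \<tau> tanh (\<tau> x)\<close>; differentiation makes
the image of the odd function even and conversely.\<close>
definition even_sol :: "real \<Rightarrow> real \<Rightarrow> real \<Rightarrow> real" where
  "even_sol \<tau> m x = free_cos m x - \<tau> * tanh (\<tau> * x) * free_sin m x"

definition odd_sol :: "real \<Rightarrow> real \<Rightarrow> real \<Rightarrow> real" where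
  "odd_sol \<tau> m x = - m * free_sin m x - \<tau> * tanh (\<tau> * x) * free_cos m x"

definition even_sol_deriv :: "real \<Rightarrow> real \<Rightarrow> real \<Rightarrow> real" where
  "even_sol_deriv \<tau> m x =
     - (m + \<tau>\<^sup>2 * (1 - (tanh (\<tau> * x))\<^sup>2)) * free_sin m x - \<tau> * tanh (\<tau> * x) * free_cos m x"

definition odd_sol_deriv :: "real \<Rightarrow> real \<Rightarrow> real \<Rightarrow> real" where
  "odd_sol_deriv \<tau> m x =
     - (m + \<tau>\<^sup>2 * (1 - (tanh (\<tau> * x))\<^sup>2)) * free_cos m x + m * \<tau> * tanh (\<tau> * x) * free_sin m x"

lemma even_sol_minus: "even_sol \<tau> m (- x) = even_sol \<tau> m x"
  and odd_sol_minus: "odd_sol \<tau> m (- x) = - odd_sol \<tau> m x"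
  by (simp_all add: even_sol_def odd_sol_def)

lemma tanh_scaled_has_derivative:
  "((\<lambda>x. tanh (\<tau> * x)) has_real_derivative \<tau> * (1 - (tanh (\<tau> * x))\<^sup>2)) (at x)"
  by (auto intro!: derivative_eq_intros)

lemma even_sol_has_derivative:
  "(even_sol \<tau> m has_real_derivative even_sol_deriv \<tau> m x) (at x)"
  unfolding even_sol_def even_sol_deriv_def
  by (rule derivative_eq_intros free_sin_has_derivative free_cos_has_derivative
      tanh_scaled_has_derivative refl | simp add: algebra_simps power2_eq_square)+

lemma odd_sol_has_derivative:
  "(odd_sol \<tau> m has_real_derivative odd_sol_deriv \<tau> m x) (at x)"
  unfolding odd_sol_def odd_sol_deriv_def
  by (rule derivative_eq_intros free_sin_has_derivative free_cos_has_derivative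
      tanh_scaled_has_derivative refl | simp add: algebra_simps power2_eq_square)+

lemma even_sol_deriv_has_derivative:
  "(even_sol_deriv \<tau> m has_real_derivative
      - (m + 2 * \<tau>\<^sup>2 * (1 - (tanh (\<tau> * x))\<^sup>2)) * even_sol \<tau> m x) (at x)"
  unfolding even_sol_def even_sol_deriv_def
  by (rule derivative_eq_intros free_sin_has_derivative free_cos_has_derivative
      tanh_scaled_has_derivative refl | simp add: algebra_simps power2_eq_square)+

lemma odd_sol_deriv_has_derivative:
  "(odd_sol_deriv \<tau> m has_real_derivative
      - (m + 2 * \<tau>\<^sup>2 * (1 - (tanh (\<tau> * x))\<^sup>2)) * odd_sol \<tau> m x) (at x)"
  unfolding odd_sol_def odd_sol_deriv_def
  by (rule derivative_eq_intros free_sin_has_derivative free_cos_has_derivative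
      tanh_scaled_has_derivative refl | simp add: algebra_simps power2_eq_square)+

text \<open>The factor that remains after expansion is the first integral \<open>C^2 + m S^2 = 1\<close> of the
free equation.\<close>
lemma wronskian_even_odd:
  "even_sol \<tau> m x * odd_sol_deriv \<tau> m x - even_sol_deriv \<tau> m x * odd_sol \<tau> m x = - (m + \<tau>\<^sup>2)"
proof -
  have "even_sol \<tau> m x * odd_sol_deriv \<tau> m x - even_sol_deriv \<tau> m x * odd_sol \<tau> m x
      = - (m + \<tau>\<^sup>2) * ((free_cos m x)\<^sup>2 + m * (free_sin m x)\<^sup>2)"
    unfolding even_sol_def odd_sol_def even_sol_deriv_def odd_sol_deriv_def by algebra
  then show ?thesis by (simp add: free_pythagoras)
qed

section \<open>Reduction of the eigenvalue problem to the boundary values\<close>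

lemma gelfand_potential:
  "gelfand_lambda \<tau> * exp (gelfand_u \<tau> x) = 2 * \<tau>\<^sup>2 * (1 - (tanh (\<tau> * x))\<^sup>2)"
proof -
  have pos: "0 < cosh \<tau> / cosh (\<tau> * x)" by simp
  have "exp (gelfand_u \<tau> x) = exp (ln (cosh \<tau> / cosh (\<tau> * x))) ^ 2"
    unfolding gelfand_u_def by (simp add: exp_double)
  also have "\<dots> = (cosh \<tau> / cosh (\<tau> * x))\<^sup>2" using pos by (simp only: exp_ln)
  finally have "gelfand_lambda \<tau> * exp (gelfand_u \<tau> x) = 2 * \<tau>\<^sup>2 * (1 / (cosh (\<tau> * x))\<^sup>2)"
    by (simp add: gelfand_lambda_def power_divide)
  also have "1 / (cosh (\<tau> * x))\<^sup>2 = 1 - (tanh (\<tau> * x))\<^sup>2"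
  proof -
    have "(tanh (\<tau> * x))\<^sup>2 * (cosh (\<tau> * x))\<^sup>2 = (sinh (\<tau> * x))\<^sup>2"
      by (simp add: tanh_def power_divide)
    then have "(1 - (tanh (\<tau> * x))\<^sup>2) * (cosh (\<tau> * x))\<^sup>2 = 1"
      using cosh_square_eq[of "\<tau> * x"] by (simp add: left_diff_distrib)
    then show ?thesis by (simp add: divide_eq_eq)
  qed
  finally show ?thesis .
qed

lemma eigenfunction_derivatives:
  assumes "is_eigenfunction \<tau> m \<phi>" "x \<in> {-1<..<1}"
  shows "(\<phi> has_real_derivative deriv \<phi> x) (at x)"
    and "(deriv \<phi> has_real_derivative - (m + 2 * \<tau>\<^sup>2 * (1 - (tanh (\<tau> * x))\<^sup>2)) * \<phi> x) (at x)"
proof -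
  have d: "\<phi> differentiable (at x)" "deriv \<phi> differentiable (at x)"
    and e: "deriv (deriv \<phi>) x + gelfand_lambda \<tau> * exp (gelfand_u \<tau> x) * \<phi> x = - m * \<phi> x"
    using assms unfolding is_eigenfunction_def by auto
  show "(\<phi> has_real_derivative deriv \<phi> x) (at x)"
    using d(1) by (simp add: DERIV_deriv_iff_real_differentiable)
  have "deriv (deriv \<phi>) x = - (m + 2 * \<tau>\<^sup>2 * (1 - (tanh (\<tau> * x))\<^sup>2)) * \<phi> x"
    using e unfolding gelfand_potential by (simp add: algebra_simps)
  then show "(deriv \<phi> has_real_derivative - (m + 2 * \<tau>\<^sup>2 * (1 - (tanh (\<tau> * x))\<^sup>2)) * \<phi> x) (at x)"
    using d(2) by (metis DERIV_deriv_iff_real_differentiable)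
qed

lemma eigenfunctionI:
  assumes f: "\<And>x. (f has_real_derivative f' x) (at x)"
    and f': "\<And>x. (f' has_real_derivative - (m + 2 * \<tau>\<^sup>2 * (1 - (tanh (\<tau> * x))\<^sup>2)) * f x) (at x)"
    and "f (-1) = 0" "f 1 = 0" "\<exists>x\<in>{-1..1}. f x \<noteq> 0"
  shows "is_eigenfunction \<tau> m f"
proof -
  have df: "deriv f = f'" using f by (auto intro: DERIV_imp_deriv)
  have "continuous_on {-1..1} f"
    using f by (meson DERIV_isCont continuous_at_imp_continuous_on)
  moreover have "f differentiable (at x)" "f' differentiable (at x)" for x
    using f f' real_differentiable_def by blast+
  moreover have "deriv f' x = - (m + 2 * \<tau>\<^sup>2 * (1 - (tanh (\<tau> * x))\<^sup>2)) * f x" for x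
    using f' by (rule DERIV_imp_deriv)
  ultimately show ?thesis
    using assms(3-) unfolding is_eigenfunction_def df gelfand_potential
    by (simp add: algebra_simps)
qed

text \<open>The function \<open>1 / cosh (\<tau> x)\<close> solves the equation for \<open>m = - \<tau>^2\<close>, so it is compared with
the eigenfunction through the quotient \<open>\<psi> = \<phi> cosh (\<tau> x)\<close>.  If \<open>m \<le> - \<tau>^2\<close>, then
\<open>q = \<psi> \<psi>' / cosh^2 (\<tau> x)\<close> is nondecreasing.  A positive value of \<open>q\<close> would make \<open>\<psi>^2\<close> increase up to
\<open>x = 1\<close>, a negative value would make it decrease from \<open>x = -1\<close>; both contradict \<open>\<psi> (-1) = \<psi> 1 = 0\<close>.
So \<open>q = 0\<close>, \<open>\<psi>\<close> is constant and vanishes.\<close>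
lemma eigenvalue_lower_bound:
  assumes eig: "is_eigenfunction \<tau> m \<phi>"
  shows "m > - \<tau>\<^sup>2"
proof (rule ccontr)
  assume "\<not> m > - \<tau>\<^sup>2"
  then have m: "m + \<tau>\<^sup>2 \<le> 0" by simp
  have cont: "continuous_on {-1..1} \<phi>" and bc: "\<phi> (-1) = 0" "\<phi> 1 = 0"
    and nz: "\<exists>x\<in>{-1..1}. \<phi> x \<noteq> 0"
    using eig unfolding is_eigenfunction_def by auto
  note D = eigenfunction_derivatives[OF eig]
  \<comment> \<open>\<open>w\<close> is \<open>\<psi>^2\<close>, and \<open>q\<close> is written without dividing by \<open>cosh\<close>.\<close>
  define q where "q x = \<phi> x * (deriv \<phi> x + \<tau> * tanh (\<tau> * x) * \<phi> x)" for x
  define w where "w x = (\<phi> x * cosh (\<tau> * x))\<^sup>2" for x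
  have Dq: "(q has_real_derivative
      (deriv \<phi> x + \<tau> * tanh (\<tau> * x) * \<phi> x)\<^sup>2 - (m + \<tau>\<^sup>2) * (\<phi> x)\<^sup>2) (at x)"
    if "x \<in> {-1<..<1}" for x
    unfolding q_def
    by (rule derivative_eq_intros D[OF that] tanh_scaled_has_derivative refl
        | simp add: algebra_simps power2_eq_square)+
  have Dw: "(w has_real_derivative 2 * (cosh (\<tau> * x))\<^sup>2 * q x) (at x)"
    if "x \<in> {-1<..<1}" for x
  proof -
    have "(w has_real_derivative
        2 * (\<phi> x * cosh (\<tau> * x)) * (deriv \<phi> x * cosh (\<tau> * x) + \<phi> x * (\<tau> * sinh (\<tau> * x)))) (at x)"
      unfolding w_def by (auto intro!: derivative_eq_intros D[OF that])
    moreover have "sinh (\<tau> * x) = tanh (\<tau> * x) * cosh (\<tau> * x)" by (simp add: tanh_def)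
    ultimately show ?thesis unfolding q_def by (simp add: algebra_simps power2_eq_square)
  qed
  have q_mono: "q x \<le> q y" if "-1 < x" "x \<le> y" "y < 1" for x y
  proof (rule DERIV_nonneg_imp_nondecreasing[OF \<open>x \<le> y\<close>])
    fix z assume z: "x \<le> z" "z \<le> y"
    with that have "z \<in> {-1<..<1}" by simp
    moreover have "0 \<le> (deriv \<phi> z + \<tau> * tanh (\<tau> * z) * \<phi> z)\<^sup>2 - (m + \<tau>\<^sup>2) * (\<phi> z)\<^sup>2"
      using mult_nonpos_nonneg[OF m zero_le_power2[of "\<phi> z"]]
        zero_le_power2[of "deriv \<phi> z + \<tau> * tanh (\<tau> * z) * \<phi> z"] by linarith
    ultimately show "\<exists>d. (q has_real_derivative d) (at z) \<and> 0 \<le> d" using Dq by blast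
  qed
  have w_cont: "continuous_on {-1..1} w"
    unfolding w_def by (intro continuous_intros cont)
  have w_bc: "w (-1) = 0" "w 1 = 0" by (simp_all add: w_def bc)
  have w_nonneg: "0 \<le> w x" for x by (simp add: w_def)
  have q_zero: "q x = 0" if x: "x \<in> {-1<..<1}" for x
  proof (rule ccontr)
    assume "q x \<noteq> 0"
    then consider "q x > 0" | "q x < 0" by linarith
    then show False
    proof cases
      case 1
      have "w x < w 1"
      proof (rule DERIV_pos_imp_increasing_open[of x 1 w])
        show "x < 1" using x by simp
        show "continuous_on {x..1} w" using w_cont x by (auto elim: continuous_on_subset)
        fix y assume y: "x < y" "y < 1"
        then have "q y > 0" using q_mono[of x y] x 1 by auto
        then have "2 * (cosh (\<tau> * y))\<^sup>2 * q y > 0" by simp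
        then show "\<exists>d. (w has_real_derivative d) (at y) \<and> d > 0" using Dw[of y] x y by auto
      qed
      then show False using w_nonneg[of x] w_bc by simp
    next
      case 2
      have "w x < w (-1)"
      proof (rule DERIV_neg_imp_decreasing_open[of "-1" x w])
        show "-1 < x" using x by simp
        show "continuous_on {-1..x} w" using w_cont x by (auto elim: continuous_on_subset)
        fix y assume y: "-1 < y" "y < x"
        then have "q y < 0" using q_mono[of y x] x 2 by auto
        then have "2 * (cosh (\<tau> * y))\<^sup>2 * q y < 0" by (simp add: mult_pos_neg)
        then show "\<exists>d. (w has_real_derivative d) (at y) \<and> d < 0" using Dw[of y] x y by auto
      qed
      then show False using w_nonneg[of x] w_bc by simp
    qed
  qed
  have "w x = w (-1)" if "x \<in> {-1..1}" for x
  proof (rule DERIV_isconst2[of "-1" 1])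
    fix y :: real assume "-1 < y" "y < 1"
    then show "(w has_real_derivative 0) (at y)" using Dw[of y] q_zero[of y] by simp
  qed (use w_cont that in auto)
  then have "\<phi> x = 0" if "x \<in> {-1..1}" for x
    using that w_bc by (simp add: w_def)
  with nz show False by blast
qed

text \<open>The Wronskians \<open>c\<close> and \<open>d\<close> of \<open>\<phi>\<close> with the two solutions are constant on the open interval, and
Cramer's rule expresses \<open>\<phi>\<close> by them, since \<open>m + \<tau>^2 \<noteq> 0\<close>.  The equation is only known in the
interior; continuity carries the identity to the endpoints.\<close>
lemma eigenfunction_combination:
  assumes eig: "is_eigenfunction \<tau> m \<phi>"
  obtains a b where "\<And>x. x \<in> {-1..1} \<Longrightarrow> \<phi> x = a * even_sol \<tau> m x + b * odd_sol \<tau> m x"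
proof -
  have M: "m + \<tau>\<^sup>2 > 0" using eigenvalue_lower_bound[OF eig] by simp
  have cont: "continuous_on {-1..1} \<phi>" using eig unfolding is_eigenfunction_def by auto
  note D = eigenfunction_derivatives[OF eig]
  have wronskian_const: "\<exists>c. \<forall>x\<in>{-1<..<1}. \<phi> x * f' x - deriv \<phi> x * f x = c"
    if f: "\<And>x. (f has_real_derivative f' x) (at x)"
      and f': "\<And>x. (f' has_real_derivative - (m + 2 * \<tau>\<^sup>2 * (1 - (tanh (\<tau> * x))\<^sup>2)) * f x) (at x)"
    for f f' :: "real \<Rightarrow> real"
  proof -
    have "((\<lambda>x. \<phi> x * f' x - deriv \<phi> x * f x) has_real_derivative 0) (at x)"
      if x: "x \<in> {-1<..<1}" for x
      by (rule derivative_eq_intros D[OF x] f f' refl | simp add: algebra_simps)+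
    then have "\<exists>c. \<forall>x\<in>{-1<..<1}. (\<lambda>x. \<phi> x * f' x - deriv \<phi> x * f x) x = c"
      by (intro has_field_derivative_zero_constant)
         (auto intro: has_field_derivative_at_within)
    then show ?thesis by simp
  qed
  obtain c d where
    c: "\<And>x. x \<in> {-1<..<1} \<Longrightarrow> \<phi> x * even_sol_deriv \<tau> m x - deriv \<phi> x * even_sol \<tau> m x = c" and
    d: "\<And>x. x \<in> {-1<..<1} \<Longrightarrow> \<phi> x * odd_sol_deriv \<tau> m x - deriv \<phi> x * odd_sol \<tau> m x = d"
    using wronskian_const[OF even_sol_has_derivative even_sol_deriv_has_derivative]
      wronskian_const[OF odd_sol_has_derivative odd_sol_deriv_has_derivative] by metis
  define r where "r x = (m + \<tau>\<^sup>2) * \<phi> x + d * even_sol \<tau> m x - c * odd_sol \<tau> m x" for x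
  have r_open: "r x = 0" if "x \<in> {-1<..<1}" for x
  proof -
    have "r x = (m + \<tau>\<^sup>2
        + (even_sol \<tau> m x * odd_sol_deriv \<tau> m x - even_sol_deriv \<tau> m x * odd_sol \<tau> m x)) * \<phi> x"
      unfolding r_def c[OF that, symmetric] d[OF that, symmetric] by algebra
    then show ?thesis unfolding wronskian_even_odd by simp
  qed
  have "continuous_on {-1..1} r"
    unfolding r_def
    by (intro continuous_intros cont continuous_at_imp_continuous_on ballI
        DERIV_isCont[OF even_sol_has_derivative] DERIV_isCont[OF odd_sol_has_derivative])
  then have r: "r x = 0" if "x \<in> {-1..1}" for x
    using continuous_constant_on_closure[of "{-1<..<1}" r 0 x] r_open that by simp
  show thesis
  proof (rule that)
    fix x :: real assume "x \<in> {-1..1}"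
    from r[OF this] have "(m + \<tau>\<^sup>2) * \<phi> x = c * odd_sol \<tau> m x - d * even_sol \<tau> m x"
      unfolding r_def by simp
    then have "\<phi> x = (c * odd_sol \<tau> m x - d * even_sol \<tau> m x) / (m + \<tau>\<^sup>2)"
      using M by (simp add: eq_divide_eq mult.commute)
    then show "\<phi> x = (- d / (m + \<tau>\<^sup>2)) * even_sol \<tau> m x + (c / (m + \<tau>\<^sup>2)) * odd_sol \<tau> m x"
      by (simp add: diff_divide_distrib)
  qed
qed

text \<open>Adding and subtracting the boundary conditions at \<open>1\<close> and \<open>-1\<close> separates the even from the odd
part.  The two solutions cannot both vanish at \<open>1\<close>, where their Wronskian is nonzero.\<close>
lemma eigenfunction_cases:
  assumes eig: "is_eigenfunction \<tau> m \<phi>"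
  shows "even_sol \<tau> m 1 = 0 \<and> odd_sol \<tau> m 1 \<noteq> 0 \<and> same_up_to_multiple \<phi> (even_sol \<tau> m) \<or>
         odd_sol \<tau> m 1 = 0 \<and> even_sol \<tau> m 1 \<noteq> 0 \<and> same_up_to_multiple \<phi> (odd_sol \<tau> m)"
proof -
  obtain a b where ab: "\<And>x. x \<in> {-1..1} \<Longrightarrow> \<phi> x = a * even_sol \<tau> m x + b * odd_sol \<tau> m x"
    using eigenfunction_combination[OF eig] by blast
  have bc: "\<phi> (-1) = 0" "\<phi> 1 = 0" and nz: "\<exists>x\<in>{-1..1}. \<phi> x \<noteq> 0"
    using eig unfolding is_eigenfunction_def by auto
  have "a * even_sol \<tau> m 1 + b * odd_sol \<tau> m 1 = 0" "a * even_sol \<tau> m 1 - b * odd_sol \<tau> m 1 = 0"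
    using ab[of 1] ab[of "-1"] bc by (simp_all add: even_sol_minus odd_sol_minus)
  then have prods: "a * even_sol \<tau> m 1 = 0" "b * odd_sol \<tau> m 1 = 0" by linarith+
  have ne: "\<not> (even_sol \<tau> m 1 = 0 \<and> odd_sol \<tau> m 1 = 0)"
    using wronskian_even_odd[of \<tau> m 1] eigenvalue_lower_bound[OF eig] by auto
  have "a \<noteq> 0 \<or> b \<noteq> 0" using nz ab by fastforce
  with prods ne consider "a \<noteq> 0" "b = 0" "even_sol \<tau> m 1 = 0" "odd_sol \<tau> m 1 \<noteq> 0"
    | "a = 0" "b \<noteq> 0" "odd_sol \<tau> m 1 = 0" "even_sol \<tau> m 1 \<noteq> 0" by auto
  then show ?thesis
  proof cases
    case 1
    then have "same_up_to_multiple \<phi> (even_sol \<tau> m)"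
      unfolding same_up_to_multiple_def using ab by auto
    with 1 show ?thesis by blast
  next
    case 2
    then have "same_up_to_multiple \<phi> (odd_sol \<tau> m)"
      unfolding same_up_to_multiple_def using ab by auto
    with 2 show ?thesis by blast
  qed
qed

lemma even_eigenvalue:
  assumes "even_sol \<tau> m 1 = 0"
  shows "is_eigenvalue \<tau> m"
proof -
  have "even_sol \<tau> m 0 \<noteq> 0" by (simp add: even_sol_def)
  then have "\<exists>x\<in>{-1..1}. even_sol \<tau> m x \<noteq> 0" by (intro bexI[of _ 0]) auto
  then show ?thesis
    unfolding is_eigenvalue_def
    using eigenfunctionI[OF even_sol_has_derivative even_sol_deriv_has_derivative, of \<tau> m]
      even_sol_minus[of \<tau> m 1] assms by auto
qed

lemma odd_eigenvalue:
  assumes "odd_sol \<tau> m 1 = 0" and "m > 0"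
  shows "is_eigenvalue \<tau> m"
proof -
  have "\<exists>x\<in>{-1..1}. odd_sol \<tau> m x \<noteq> 0"
  proof (rule ccontr)
    assume "\<not> ?thesis"
    then have z: "odd_sol \<tau> m x = 0" if "\<bar>0 - x\<bar> < 1" for x
      using that by (auto simp: abs_le_iff abs_less_iff)
    have "odd_sol_deriv \<tau> m 0 = 0"
      by (rule DERIV_local_const[OF odd_sol_has_derivative, of 1]) (use z in auto)
    then show False using assms(2) zero_le_power2[of \<tau>] by (simp add: odd_sol_deriv_def)
  qed
  then show ?thesis
    unfolding is_eigenvalue_def
    using eigenfunctionI[OF odd_sol_has_derivative odd_sol_deriv_has_derivative, of \<tau> m]
      odd_sol_minus[of \<tau> m 1] assms(1) by auto
qed

section \<open>The transcendental equations\<close>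

text \<open>By the mean value theorem the slope of \<open>f\<close> over \<open>{0..s}\<close> exceeds the slope over \<open>{s..t}\<close>, so
\<open>f t / t\<close> is strictly decreasing.  Applied to \<open>arctan\<close> and \<open>tanh\<close>, this gives the uniqueness of the
solutions of both transcendental equations.\<close>
lemma decreasing_derivative_chord:
  fixes f f' :: "real \<Rightarrow> real"
  assumes D: "\<And>x. (f has_real_derivative f' x) (at x)" and "f 0 = 0"
    and dec: "\<And>x y. 0 \<le> x \<Longrightarrow> x < y \<Longrightarrow> f' y < f' x"
    and "0 < s"
  shows "f s < s * f' 0" and "s < t \<Longrightarrow> s * f t < t * f s"
proof -
  obtain u where u: "0 < u" "u < s" "f s = s * f' u"
    using MVT2[OF \<open>0 < s\<close>, of f f'] D \<open>f 0 = 0\<close> by auto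
  show "f s < s * f' 0" using u dec[of 0 u] \<open>0 < s\<close> by simp
  assume "s < t"
  then obtain v where v: "s < v" "v < t" "f t - f s = (t - s) * f' v"
    using MVT2[of s t f f'] D by auto
  have "f' v < f' u" using dec[of u v] u v by simp
  then have "s * (t - s) * f' v < s * (t - s) * f' u" using \<open>0 < s\<close> \<open>s < t\<close> by simp
  moreover have "s * f t - t * f s = s * (t - s) * f' v - s * (t - s) * f' u"
    using u v by algebra
  ultimately show "s * f t < t * f s" by linarith
qed

lemma arctan_chord:
  fixes s t :: real
  assumes "0 < s"
  shows "arctan s < s" and "s < t \<Longrightarrow> s * arctan t < t * arctan s"
proof -
  have dec: "inverse (1 + y\<^sup>2) < inverse (1 + x\<^sup>2)" if "0 \<le> x" "x < y" for x y :: real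
    using that by (intro less_imp_inverse_less) (auto simp: power_strict_mono add_pos_nonneg)
  note chord = decreasing_derivative_chord[of arctan "\<lambda>x. inverse (1 + x\<^sup>2)", OF DERIV_arctan _ dec assms]
  show "arctan s < s" using chord(1) by simp
  show "s < t \<Longrightarrow> s * arctan t < t * arctan s" using chord(2) by simp
qed

lemma tanh_chord:
  fixes s t :: real
  assumes "0 < s"
  shows "tanh s < s" and "s < t \<Longrightarrow> s * tanh t < t * tanh s"
proof -
  have D: "(tanh has_real_derivative 1 - (tanh x)\<^sup>2) (at x)" for x :: real
    by (auto intro!: derivative_eq_intros)
  have dec: "1 - (tanh y)\<^sup>2 < 1 - (tanh x)\<^sup>2" if "0 \<le> x" "x < y" for x y :: real
    using that by (simp add: power_strict_mono)
  note chord = decreasing_derivative_chord[of tanh "\<lambda>x. 1 - (tanh x)\<^sup>2", OF D _ dec assms]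
  show "tanh s < s" using chord(1) by simp
  show "s < t \<Longrightarrow> s * tanh t < t * tanh s" using chord(2) by simp
qed

lemma times_tanh_strict_mono: "0 \<le> s \<Longrightarrow> s < t \<Longrightarrow> s * tanh s < t * tanh (t::real)"
  by (intro mult_strict_mono) auto

text \<open>For \<open>k > 0\<close> this is \<open>k + arctan (a / k) - \<pi> / 2\<close>, the argument of the sine form at \<open>x = 1\<close> up
to a multiple of \<open>\<pi> / 2\<close>.  The chosen expression is smooth also at \<open>k = 0\<close>, where it vanishes.\<close>
definition phase :: "real \<Rightarrow> real \<Rightarrow> real" where
  "phase a k = k - arctan (k / a)"

text \<open>The equation for the \<open>j\<close>-th eigenvalue, with \<open>a\<close> standing for \<open>\<tau> tanh \<tau>\<close>.  A non-positive
eigenvalue can only be the first one.\<close>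
definition nth_eigenvalue :: "real \<Rightarrow> nat \<Rightarrow> real \<Rightarrow> bool" where
  "nth_eigenvalue a j m \<longleftrightarrow>
     m > 0 \<and> phase a (sqrt m) = pi / 2 * (real j - 1) \<or>
     j = 1 \<and> m = 0 \<and> a = 1 \<or>
     j = 1 \<and> m < 0 \<and> a * tanh (sqrt (- m)) = sqrt (- m)"

lemma sin_phase_eq_0_iff:
  assumes "a > 0" shows "sin (phase a k) = 0 \<longleftrightarrow> k * cos k = a * sin k"
proof -
  have "sqrt (1 + (k / a)\<^sup>2) > 0" by (simp add: add_pos_nonneg)
  then have "sin (phase a k) = (a * sin k - k * cos k) / (a * sqrt (1 + (k / a)\<^sup>2))"
    unfolding phase_def using assms
    by (simp add: sin_diff cos_arctan sin_arctan) (simp add: field_simps)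
  then show ?thesis using assms \<open>sqrt _ > 0\<close> by auto
qed

lemma cos_phase_eq_0_iff:
  assumes "a > 0" shows "cos (phase a k) = 0 \<longleftrightarrow> k * sin k = - a * cos k"
proof -
  have "sqrt (1 + (k / a)\<^sup>2) > 0" by (simp add: add_pos_nonneg)
  then have "cos (phase a k) = (a * cos k + k * sin k) / (a * sqrt (1 + (k / a)\<^sup>2))"
    unfolding phase_def using assms
    by (simp add: cos_diff cos_arctan sin_arctan) (simp add: field_simps)
  then show ?thesis using assms \<open>sqrt _ > 0\<close> by auto
qed

lemma phase_bounds:
  assumes "a > 0" "k > 0" shows "k - pi / 2 < phase a k" "phase a k < k"
  using assms arctan_ubound[of "k / a"] by (auto simp: phase_def)

text \<open>For \<open>a < 1\<close> the phase first decreases from \<open>0\<close> and is not injective; but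
\<open>phase a k / k = 1 - arctan (k / a) / k\<close> is strictly increasing, so the phase itself is
strictly increasing once it is nonnegative.\<close>
lemma phase_inj:
  assumes a: "a > 0" and k: "0 < k" "0 < l" and eq: "phase a k = phase a l" and nonneg: "0 \<le> phase a k"
  shows "k = l"
proof -
  have less: "phase a s < phase a t" if "0 < s" "s < t" "0 \<le> phase a s" for s t
  proof -
    have "s / a * arctan (t / a) < t / a * arctan (s / a)"
      by (rule arctan_chord(2)) (use that a in \<open>auto simp: divide_strict_right_mono\<close>)
    then have "t * phase a s < s * phase a t"
      using a by (simp add: phase_def field_simps)
    moreover have "s * phase a s \<le> t * phase a s" using that by (intro mult_right_mono) auto
    ultimately have "s * phase a s < s * phase a t" by linarith
    then show ?thesis using that by simp
  qed
  show ?thesis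
    using less[of k l] less[of l k] k eq nonneg by (cases k l rule: linorder_cases) auto
qed

text \<open>Intermediate value theorem.  At \<open>k = c + \<pi> / 2\<close> the phase is above \<open>c\<close>.  It is below \<open>c\<close> at \<open>k = c\<close>
if \<open>c > 0\<close>; if \<open>c = 0\<close>, it is negative for small \<open>k > 0\<close> because its derivative at \<open>0\<close> is
\<open>1 - 1 / a < 0\<close>.\<close>
lemma phase_surj:
  assumes a: "a > 0" and c: "0 < c \<or> c = 0 \<and> a < 1"
  obtains k where "k > 0" "phase a k = c"
proof -
  have D: "(phase a has_real_derivative 1 - 1 / a * inverse (1 + (k / a)\<^sup>2)) (at k)" for k
    unfolding phase_def using a by (auto intro!: derivative_eq_intros simp: field_simps)
  obtain s where s: "0 < s" "s \<le> c + pi / 2" "phase a s < c"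
  proof (cases "0 < c")
    case True
    then show thesis using that[of c] phase_bounds(2)[OF a True] by simp
  next
    case False
    with c have c0: "c = 0" "a < 1" by auto
    have "1 - 1 / a * inverse (1 + (0 / a)\<^sup>2) < 0" using c0 a by (simp add: field_simps)
    from DERIV_neg_dec_right[OF D[of 0] this] obtain d where
      "d > 0" "\<And>h. 0 < h \<Longrightarrow> h < d \<Longrightarrow> phase a h < phase a 0" by auto
    then have "phase a (min (d / 2) (pi / 2)) < 0" by (simp add: phase_def min_def)
    then show thesis using that[of "min (d / 2) (pi / 2)"] c0 \<open>d > 0\<close> by simp
  qed
  have "c \<le> phase a (c + pi / 2)"
    using phase_bounds(1)[OF a, of "c + pi / 2"] c pi_gt_zero by (auto simp: add_pos_pos)
  then obtain k where "s \<le> k" "phase a k = c"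
    using IVT'[of "phase a" s c "c + pi / 2"] s D
    by (meson DERIV_isCont continuous_at_imp_continuous_on less_imp_le)
  then show thesis using that[of k] s by simp
qed

text \<open>The inequalities \<open>arctan t < t\<close> and \<open>tanh t < t\<close> for \<open>t > 0\<close> decide which of the three
equations can have a solution.\<close>
lemma nth_eigenvalue_1_cases:
  assumes a: "a > 0" and "nth_eigenvalue a 1 m"
  shows "a < 1 \<and> m > 0 \<or> a = 1 \<and> m = 0 \<or> a > 1 \<and> m < 0"
  using assms(2) unfolding nth_eigenvalue_def
proof (elim disjE conjE)
  assume m: "m > 0" and p: "phase a (sqrt m) = pi / 2 * (real 1 - 1)"
  have "sqrt m < sqrt m / a"
    using p arctan_chord(1)[of "sqrt m / a"] m a by (simp add: phase_def)
  then have "a < 1" using a m by (simp add: field_simps)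
  with m show ?thesis by blast
next
  assume m: "m < 0" and p: "a * tanh (sqrt (- m)) = sqrt (- m)"
  have "tanh (sqrt (- m)) < a * tanh (sqrt (- m))"
    unfolding p using m by (intro tanh_chord(1)) simp
  then have "a > 1" using m by simp
  with m show ?thesis by blast
qed auto

lemma nth_eigenvalue_pos:
  assumes "nth_eigenvalue a j m" "j \<noteq> 1"
  shows "m > 0"
  using assms unfolding nth_eigenvalue_def by auto

lemma nth_eigenvalue_unique:
  assumes a: "a > 0" and j: "1 \<le> j" and m: "nth_eigenvalue a j m" and n: "nth_eigenvalue a j n"
  shows "m = n"
proof -
  have pos: "m = n" if "m > 0" "n > 0"
  proof -
    have p: "phase a (sqrt m) = pi / 2 * (real j - 1)" "phase a (sqrt n) = pi / 2 * (real j - 1)"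
      using m n that unfolding nth_eigenvalue_def by auto
    have "sqrt m = sqrt n"
    proof (rule phase_inj[OF a])
      show "0 \<le> phase a (sqrt m)" unfolding p using j by simp
    qed (use that p in auto)
    then show ?thesis by simp
  qed
  have neg: "m = n" if "m < 0" "n < 0"
  proof -
    have p: "a * tanh (sqrt (- m)) = sqrt (- m)" "a * tanh (sqrt (- n)) = sqrt (- n)"
      using m n that unfolding nth_eigenvalue_def by auto
    have no: False if "0 < s" "s < t" "a * tanh s = s" "a * tanh t = t" for s t :: real
      using tanh_chord(2)[OF that(1,2)] that a
      by (metis mult.assoc mult.commute less_irrefl mult_less_cancel_left_pos)
    have "sqrt (- m) = sqrt (- n)"
      using no[of "sqrt (- m)" "sqrt (- n)"] no[of "sqrt (- n)" "sqrt (- m)"] p that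
      by (cases "sqrt (- m)" "sqrt (- n)" rule: linorder_cases) auto
    then show ?thesis by simp
  qed
  show ?thesis
  proof (cases "j = 1")
    case True
    then show ?thesis
      using nth_eigenvalue_1_cases[OF a, of m] nth_eigenvalue_1_cases[OF a, of n] m n pos neg by auto
  next
    case False
    then show ?thesis using nth_eigenvalue_pos m n pos by blast
  qed
qed

text \<open>The bounds \<open>(j - 1) \<pi> / 2 < sqrt m < j \<pi> / 2\<close> put the roots for different \<open>j\<close> into disjoint
intervals.\<close>
lemma nth_eigenvalue_less:
  assumes a: "a > 0" and ij: "1 \<le> i" "i < j"
    and m: "nth_eigenvalue a i m" and n: "nth_eigenvalue a j n"
  shows "m < n"
proof (cases "m > 0")
  case True
  have "n > 0" using nth_eigenvalue_pos[OF n] ij by simp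
  then have "sqrt n > pi / 2 * (real j - 1)"
    using n phase_bounds(2)[OF a, of "sqrt n"] ij unfolding nth_eigenvalue_def by auto
  moreover have "sqrt m - pi / 2 < pi / 2 * (real i - 1)"
    using m phase_bounds(1)[OF a, of "sqrt m"] True unfolding nth_eigenvalue_def by auto
  moreover have "pi / 2 * real i \<le> pi / 2 * (real j - 1)"
    using ij by (intro mult_left_mono) auto
  ultimately have "sqrt m < sqrt n" by (simp add: algebra_simps del: real_sqrt_less_iff)
  then show ?thesis by simp
next
  case False
  then show ?thesis using nth_eigenvalue_pos[OF n] ij by simp
qed

lemma nth_eigenvalue_exists:
  assumes \<tau>: "\<tau> > 0" and a: "a = \<tau> * tanh \<tau>" and j: "1 \<le> j"
  shows "\<exists>m. nth_eigenvalue a j m"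
proof -
  have a0: "a > 0" using \<tau> a by simp
  have main: ?thesis if "j > 1 \<or> a < 1"
  proof -
    have "0 < pi / 2 * (real j - 1) \<or> pi / 2 * (real j - 1) = 0 \<and> a < 1"
      using j that by (cases "j = 1") (auto intro!: mult_pos_pos)
    from phase_surj[OF a0 this] obtain k where "k > 0" "phase a k = pi / 2 * (real j - 1)" by blast
    then have "nth_eigenvalue a j (k\<^sup>2)" unfolding nth_eigenvalue_def by simp
    then show ?thesis by blast
  qed
  consider "j > 1 \<or> a < 1" | "j = 1" "a = 1" | "j = 1" "a > 1" using j by linarith
  then show ?thesis
  proof cases
    case 1 then show ?thesis by (rule main)
  next
    case 2 then show ?thesis unfolding nth_eigenvalue_def by blast
  next
    case 3
    \<comment> \<open>\<open>g\<close> is positive for small \<open>k > 0\<close>, as \<open>g' 0 = a - 1 > 0\<close>, and \<open>g \<tau> = \<tau> (tanh^2 \<tau> - 1) < 0\<close>.\<close>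
    define g where "g k = a * tanh k - k" for k
    have D: "(g has_real_derivative a * (1 - (tanh k)\<^sup>2) - 1) (at k)" for k
      unfolding g_def by (auto intro!: derivative_eq_intros)
    have "a * (1 - (tanh 0)\<^sup>2) - 1 > 0" using 3 by simp
    from DERIV_pos_inc_right[OF D[of 0] this] obtain d where
      d: "d > 0" "\<And>h. 0 < h \<Longrightarrow> h < d \<Longrightarrow> g 0 < g h" by auto
    define s where "s = min (d / 2) \<tau>"
    have s: "0 < s" "s \<le> \<tau>" "s < d" using d(1) \<tau> by (auto simp: s_def)
    then have gs: "0 \<le> g s" using d(2)[of s] by (simp add: g_def)
    have "(tanh \<tau>)\<^sup>2 < 1" using tanh_real_bounds[of \<tau>] by (simp add: abs_square_less_1 abs_less_iff)
    then have "g \<tau> \<le> 0" using \<tau> by (simp add: g_def a power2_eq_square mult.assoc)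
    then obtain k where k: "s \<le> k" "g k = 0"
      using IVT2'[of g \<tau> 0 s] s gs D
      by (meson DERIV_isCont continuous_at_imp_continuous_on)
    then have "nth_eigenvalue a 1 (- (k\<^sup>2))" using s unfolding nth_eigenvalue_def g_def by simp
    with 3 show ?thesis by blast
  qed
qed

lemma nth_eigenvalue_even_sol:
  assumes \<tau>: "\<tau> > 0" and a: "a = \<tau> * tanh \<tau>" and "odd j" and m: "nth_eigenvalue a j m"
  shows "even_sol \<tau> m 1 = 0"
proof -
  have a0: "a > 0" using \<tau> a by simp
  from m consider "m > 0" "phase a (sqrt m) = pi / 2 * (real j - 1)" | "m = 0" "a = 1"
    | "m < 0" "a * tanh (sqrt (- m)) = sqrt (- m)"
    unfolding nth_eigenvalue_def by blast
  then show ?thesis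
  proof cases
    case 1
    obtain i where "j = 2 * i + 1" using \<open>odd j\<close> oddE by blast
    then have "phase a (sqrt m) = real i * pi" using 1 by simp
    then have "sin (phase a (sqrt m)) = 0" by simp
    then have "sqrt m * cos (sqrt m) = a * sin (sqrt m)" using sin_phase_eq_0_iff[OF a0] by blast
    then show ?thesis using 1 a by (simp add: even_sol_def free_sin_def free_cos_def field_simps)
  next
    case 2
    then show ?thesis using a by (simp add: even_sol_def free_sin_def free_cos_def)
  next
    case 3
    then have "a * sinh (sqrt (- m)) = sqrt (- m) * cosh (sqrt (- m))"
      by (simp add: tanh_def field_simps)
    then show ?thesis using 3 a by (simp add: even_sol_def free_sin_def free_cos_def field_simps)
  qed
qed

lemma nth_eigenvalue_odd_sol:
  assumes \<tau>: "\<tau> > 0" and a: "a = \<tau> * tanh \<tau>" and "even j" and m: "nth_eigenvalue a j m"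
  shows "odd_sol \<tau> m 1 = 0"
proof -
  have a0: "a > 0" using \<tau> a by simp
  have m0: "m > 0" using nth_eigenvalue_pos[OF m] \<open>even j\<close> by auto
  then have p: "phase a (sqrt m) = pi / 2 * (real j - 1)" using m unfolding nth_eigenvalue_def by auto
  obtain i where "j = 2 * i" using \<open>even j\<close> evenE by blast
  then have "phase a (sqrt m) = real i * pi - pi / 2" using p by (simp add: algebra_simps)
  then have "cos (phase a (sqrt m)) = 0" by (simp add: cos_diff)
  then have "sqrt m * sin (sqrt m) = - a * cos (sqrt m)" using cos_phase_eq_0_iff[OF a0] by blast
  moreover have "m * (sin (sqrt m) / sqrt m) = sqrt m * sin (sqrt m)"
    using m0 by (simp add: field_simps)
  ultimately show ?thesis
    using m0 a by (simp add: odd_sol_def free_sin_def free_cos_def)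
qed

text \<open>For positive \<open>m\<close> the condition at \<open>1\<close> says \<open>sin (2 * phase a k) = 0\<close>, which covers both parities.
For \<open>m = - k^2 < 0\<close> the odd solution would need \<open>k tanh k = \<tau> tanh \<tau>\<close>, hence \<open>k = \<tau>\<close>,
which the lower bound \<open>m > - \<tau>^2\<close> excludes.\<close>
lemma eigenvalue_iff_nth:
  assumes \<tau>: "\<tau> > 0" and a: "a = \<tau> * tanh \<tau>"
  shows "is_eigenvalue \<tau> m \<longleftrightarrow> (\<exists>j\<ge>1. nth_eigenvalue a j m)"
proof
  assume "\<exists>j\<ge>1. nth_eigenvalue a j m"
  then obtain j where j: "j \<ge> 1" "nth_eigenvalue a j m" by blast
  show "is_eigenvalue \<tau> m"
  proof (cases "even j")
    case True
    then have "m > 0" using nth_eigenvalue_pos[OF j(2)] by auto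
    then show ?thesis using odd_eigenvalue nth_eigenvalue_odd_sol[OF \<tau> a True j(2)] by blast
  next
    case False
    then show ?thesis using even_eigenvalue nth_eigenvalue_even_sol[OF \<tau> a False j(2)] by blast
  qed
next
  assume "is_eigenvalue \<tau> m"
  then obtain \<phi> where eig: "is_eigenfunction \<tau> m \<phi>" unfolding is_eigenvalue_def by blast
  have a0: "a > 0" using \<tau> a by simp
  have bc: "even_sol \<tau> m 1 = 0 \<or> odd_sol \<tau> m 1 = 0" using eigenfunction_cases[OF eig] by blast
  consider "m > 0" | "m = 0" | "m < 0" by linarith
  then show "\<exists>j\<ge>1. nth_eigenvalue a j m"
  proof cases
    case 1
    define k where "k = sqrt m"
    have k: "k > 0" "k * k = m" using 1 by (auto simp: k_def)
    have "sin (phase a k) = 0 \<or> cos (phase a k) = 0"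
      using bc
    proof
      assume "even_sol \<tau> m 1 = 0"
      then have "k * cos k = a * sin k"
        using 1 k a by (simp add: even_sol_def free_sin_def free_cos_def k_def[symmetric] field_simps)
      then show ?thesis using sin_phase_eq_0_iff[OF a0] by blast
    next
      assume "odd_sol \<tau> m 1 = 0"
      then have "- (k * k) * (sin k / k) - a * cos k = 0"
        using 1 k a by (simp add: odd_sol_def free_sin_def free_cos_def k_def[symmetric])
      then have "k * sin k = - a * cos k" using k(1) by simp
      then show ?thesis using cos_phase_eq_0_iff[OF a0] by blast
    qed
    then have "sin (2 * phase a k) = 0" by (auto simp: sin_double)
    then obtain i :: int where i: "2 * phase a k = of_int i * pi"
      by (auto simp: sin_zero_iff_int2)
    \<comment> \<open>The phase exceeds \<open>- \<pi> / 2\<close>, which excludes the roots of the sine with negative index.\<close>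
    have "(- 1) * pi < of_int i * pi" using phase_bounds(1)[OF a0 k(1)] k(1) i by linarith
    then have "i \<ge> 0" by (simp only: mult_less_cancel_right) (use pi_gt_zero in auto)
    then have "phase a (sqrt m) = pi / 2 * (real (nat i + 1) - 1)"
      using i \<open>i \<ge> 0\<close> by (simp add: k_def algebra_simps)
    then show ?thesis using 1 unfolding nth_eigenvalue_def by (intro exI[of _ "nat i + 1"]) auto
  next
    case 2
    then have "a = 1" using bc a a0 by (auto simp: even_sol_def odd_sol_def free_sin_def free_cos_def)
    with 2 show ?thesis unfolding nth_eigenvalue_def by auto
  next
    case 3
    define k where "k = sqrt (- m)"
    have k: "k > 0" "k * k = - m" using 3 by (auto simp: k_def)
    have "k\<^sup>2 < \<tau>\<^sup>2" using eigenvalue_lower_bound[OF eig] k by (simp add: power2_eq_square)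
    then have "k < \<tau>" using \<tau> by (simp add: power_less_imp_less_base)
    then have less: "k * tanh k < a" unfolding a using k by (intro times_tanh_strict_mono) auto
    have "odd_sol \<tau> m 1 = k * k * (sinh k / k) - a * cosh k"
      using 3 k a by (simp add: odd_sol_def free_sin_def free_cos_def k_def[symmetric])
    also have "\<dots> = (k * tanh k - a) * cosh k" using k(1) by (simp add: tanh_def field_simps)
    finally have "odd_sol \<tau> m 1 \<noteq> 0" using less cosh_real_pos[of k] by simp
    then have "even_sol \<tau> m 1 = 0" using bc by blast
    then have "a * sinh k = k * cosh k"
      using 3 k a by (simp add: even_sol_def free_sin_def free_cos_def k_def[symmetric] field_simps)
    then have "a * tanh k = k" by (simp add: tanh_def field_simps)
    then show ?thesis using 3 unfolding nth_eigenvalue_def k_def by auto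
  qed
qed

section \<open>Identification of the sequence\<close>

text \<open>If \<open>f j\<close> occurs in \<open>g\<close> at an index \<open>n\<close>, then \<open>n \<ge> j\<close>, because the earlier values of \<open>g\<close> are
values of \<open>f\<close> below \<open>f j\<close>.  Used symmetrically as the induction step of the next lemma.\<close>
lemma strict_mono_on_same_range_le:
  fixes f g :: "nat \<Rightarrow> 'a :: linorder"
  assumes f: "strict_mono_on {1..} f" and g: "strict_mono_on {1..} g"
    and sub: "f ` {1..} \<subseteq> g ` {1..}" and j: "1 \<le> j"
    and prefix: "\<And>i. i < j \<Longrightarrow> 1 \<le> i \<Longrightarrow> f i = g i"
  shows "g j \<le> f j"
proof -
  have "f j \<in> g ` {1..}" using sub j by auto
  then obtain n where n: "n \<ge> 1" "f j = g n" by auto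
  have "\<not> n < j"
  proof
    assume "n < j"
    then have "f n = f j" using prefix n by simp
    moreover have "f n < f j" using strict_mono_onD[OF f _ _ \<open>n < j\<close>] n(1) j by simp
    ultimately show False by simp
  qed
  then consider "n = j" | "j < n" by linarith
  then show ?thesis
  proof cases
    case 2
    then have "g j < g n" using strict_mono_onD[OF g _ _ 2] n(1) j by simp
    with n show ?thesis by simp
  qed (use n in simp)
qed

lemma strict_mono_on_same_range_eq:
  fixes f g :: "nat \<Rightarrow> 'a :: linorder"
  assumes f: "strict_mono_on {1..} f" and g: "strict_mono_on {1..} g"
    and eq: "f ` {1..} = g ` {1..}"
  shows "1 \<le> j \<Longrightarrow> f j = g j"
proof (induction j rule: less_induct)
  case (less j)
  show ?case
    using strict_mono_on_same_range_le[OF f g _ less.prems less.IH]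
      strict_mono_on_same_range_le[OF g f _ less.prems less.IH[symmetric]] eq
    by (simp add: antisym)
qed

lemma eigenvalue_sequence_nth:
  assumes \<tau>: "\<tau> > 0" and a: "a = \<tau> * tanh \<tau>" and seq: "eigenvalue_sequence \<tau> \<mu>" and j: "1 \<le> j"
  shows "nth_eigenvalue a j (\<mu> j)"
proof -
  have a0: "a > 0" using \<tau> a by simp
  define f where "f i = (SOME m. nth_eigenvalue a i m)" for i
  have f: "nth_eigenvalue a i (f i)" if "1 \<le> i" for i
    unfolding f_def using nth_eigenvalue_exists[OF \<tau> a that] by (rule someI_ex)
  have "strict_mono_on {1..} f"
    using nth_eigenvalue_less[OF a0 _ _ f f] by (auto simp: strict_mono_on_def)
  moreover have "f ` {1..} = {m. is_eigenvalue \<tau> m}"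
  proof (intro set_eqI iffI)
    fix m assume "m \<in> f ` {1..}"
    then show "m \<in> {m. is_eigenvalue \<tau> m}" using eigenvalue_iff_nth[OF \<tau> a] f by auto
  next
    fix m assume "m \<in> {m. is_eigenvalue \<tau> m}"
    then obtain i where "1 \<le> i" "nth_eigenvalue a i m" using eigenvalue_iff_nth[OF \<tau> a] by auto
    then show "m \<in> f ` {1..}" using nth_eigenvalue_unique[OF a0 _ _ f[of i]] by auto
  qed
  ultimately have "\<mu> j = f j"
    using seq unfolding eigenvalue_sequence_def
    by (intro strict_mono_on_same_range_eq[OF _ _ _ j]) auto
  with f[OF j] show ?thesis by simp
qed

text \<open>At \<open>b = 1 / tanh 1 \<ge> 1\<close> the increasing function \<open>t tanh t\<close> is at least \<open>b tanh 1 = 1\<close>.\<close>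
lemma tau1_props: "0 < tau1" "tau1 * tanh tau1 = 1"
proof -
  define b :: real where "b = 1 / tanh 1"
  have t1: "0 < tanh (1::real)" "tanh (1::real) < 1" using tanh_real_lt_1 by auto
  have b: "1 \<le> b" unfolding b_def using t1 by (simp add: field_simps)
  have "b * tanh 1 \<le> b * tanh b" using b by (intro mult_left_mono) auto
  then have "1 \<le> b * tanh b" using t1 by (simp add: b_def)
  moreover have "continuous_on {0..b} (\<lambda>t. t * tanh t)" by (intro continuous_intros) simp
  ultimately have "\<exists>t\<ge>0. t \<le> b \<and> t * tanh t = 1"
    using IVT'[of "\<lambda>t. t * tanh t" 0 1 b] b by simp
  then obtain t :: real where t: "0 \<le> t" "t * tanh t = 1" by blast
  have "t \<noteq> 0" using t(2) by (metis mult_zero_left zero_neq_one)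
  with t(1) have t0: "0 < t" by linarith
  have "0 < tau1 \<and> tau1 * tanh tau1 = 1"
    unfolding tau1_def
  proof (rule theI[of _ t])
    show "0 < t \<and> t * tanh t = 1" using t(2) t0 by blast
    fix s :: real assume "0 < s \<and> s * tanh s = 1"
    then show "s = t"
      using times_tanh_strict_mono[of s t] times_tanh_strict_mono[of t s] t
      by (metis less_irrefl less_imp_le linorder_neqE)
  qed
  then show "0 < tau1" "tau1 * tanh tau1 = 1" by auto
qed

section \<open>The explicit eigenfunctions\<close>

lemma same_up_to_multiple_scale:
  assumes "same_up_to_multiple f g" "c \<noteq> 0" "\<And>x. h x = c * g x"
  shows "same_up_to_multiple f h"
proof -
  obtain d where "d \<noteq> 0" "\<forall>x\<in>{-1..1}. f x = d * g x"
    using assms(1) unfolding same_up_to_multiple_def by blast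
  then show ?thesis
    unfolding same_up_to_multiple_def using assms(2,3) by (intro exI[of _ "d / c"]) simp
qed

text \<open>With \<open>\<theta> = arctan (\<tau> T / k)\<close>, where \<open>k = sqrt m\<close> and \<open>T = tanh (\<tau> x)\<close>, the amplitude is
\<open>(k / \<tau>) / cos \<theta>\<close>, so the addition theorem removes all square roots but \<open>k\<close>.  The shift
\<open>j \<pi> / 2\<close> then selects one of the two basis solutions, up to sign.\<close>
lemma sine_form_expand:
  assumes \<tau>: "\<tau> > 0" and m: "m > 0"
  shows "sine_form \<tau> m j x =
     (sqrt m * sin (sqrt m * x + pi / 2 * real j)
      + \<tau> * tanh (\<tau> * x) * cos (sqrt m * x + pi / 2 * real j)) / \<tau>"
proof -
  define k where "k = sqrt m"
  define T where "T = tanh (\<tau> * x)"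
  define y where "y = k * x + pi / 2 * real j"
  define r where "r = sqrt (1 + (\<tau> * T / k)\<^sup>2)"
  have k: "k > 0" "k\<^sup>2 = m" using m by (auto simp: k_def)
  have r: "r > 0" by (simp add: r_def add_pos_nonneg)
  have "m / \<tau>\<^sup>2 + T\<^sup>2 = (k / \<tau>)\<^sup>2 * (1 + (\<tau> * T / k)\<^sup>2)"
    using \<tau> k m by (simp add: field_simps)
  then have amp: "sqrt (m / \<tau>\<^sup>2 + T\<^sup>2) = k / \<tau> * r"
    using \<tau> k by (simp add: real_sqrt_mult r_def)
  have "sine_form \<tau> m j x = k / \<tau> * r * sin (y + arctan (\<tau> * T / k))"
    unfolding sine_form_def T_def[symmetric] k_def[symmetric] amp y_def by (simp add: algebra_simps)
  also have "\<dots> = k / \<tau> * (sin y + \<tau> * T / k * cos y)"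
    unfolding sin_add cos_arctan sin_arctan r_def[symmetric] using r by (simp add: ring_distribs)
  also have "\<dots> = (k * sin y + \<tau> * T * cos y) / \<tau>" using k \<tau> by (simp add: field_simps)
  finally show ?thesis by (simp add: k_def T_def y_def)
qed

lemma sine_form_odd_index:
  assumes \<tau>: "\<tau> > 0" and m: "m > 0" and j: "j = 2 * i + 1"
  shows "sine_form \<tau> m j x = (- 1) ^ i * sqrt m / \<tau> * even_sol \<tau> m x"
proof -
  have e: "pi / 2 * real j = pi / 2 + real i * pi" using j by (simp add: algebra_simps)
  have "sin (sqrt m * x + pi / 2 * real j) = (- 1) ^ i * cos (sqrt m * x)"
    "cos (sqrt m * x + pi / 2 * real j) = - ((- 1) ^ i * sin (sqrt m * x))"
    unfolding e by (simp_all add: sin_add cos_add)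
  then show ?thesis
    using m \<tau> by (simp add: sine_form_expand even_sol_def free_sin_def free_cos_def field_simps)
qed

lemma sine_form_even_index:
  assumes \<tau>: "\<tau> > 0" and m: "m > 0" and j: "j = 2 * i"
  shows "sine_form \<tau> m j x = - ((- 1) ^ i) / \<tau> * odd_sol \<tau> m x"
proof -
  have e: "pi / 2 * real j = real i * pi" using j by simp
  have "sin (sqrt m * x + pi / 2 * real j) = (- 1) ^ i * sin (sqrt m * x)"
    "cos (sqrt m * x + pi / 2 * real j) = (- 1) ^ i * cos (sqrt m * x)"
    unfolding e by (simp_all add: sin_add cos_add)
  moreover have "m * (sin (sqrt m * x) / sqrt m) = sqrt m * sin (sqrt m * x)"
    using m by (simp add: field_simps)
  ultimately show ?thesis
    using m \<tau> by (simp add: sine_form_expand odd_sol_def free_sin_def free_cos_def field_simps)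
qed

lemma eigenfunction_sine_form:
  assumes \<tau>: "\<tau> > 0" and a: "a = \<tau> * tanh \<tau>"
    and n: "nth_eigenvalue a j m" and m: "m > 0" and eig: "is_eigenfunction \<tau> m \<phi>"
  shows "same_up_to_multiple \<phi> (sine_form \<tau> m j)"
proof (cases "even j")
  case True
  then obtain i where i: "j = 2 * i" by (rule evenE)
  have "same_up_to_multiple \<phi> (odd_sol \<tau> m)"
    using eigenfunction_cases[OF eig] nth_eigenvalue_odd_sol[OF \<tau> a True n] by blast
  then show ?thesis
    by (rule same_up_to_multiple_scale[OF _ _ sine_form_even_index[OF \<tau> m i]]) (use \<tau> in simp)
next
  case False
  then obtain i where i: "j = 2 * i + 1" by (rule oddE)
  have "same_up_to_multiple \<phi> (even_sol \<tau> m)"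
    using eigenfunction_cases[OF eig] nth_eigenvalue_even_sol[OF \<tau> a False n] by blast
  then show ?thesis
    by (rule same_up_to_multiple_scale[OF _ _ sine_form_odd_index[OF \<tau> m i]]) (use \<tau> m in simp)
qed

theorem theorem1p2:
  fixes \<tau> :: real and \<mu> :: "nat \<Rightarrow> real" and \<phi> :: "nat \<Rightarrow> real \<Rightarrow> real"
  assumes "0 < \<tau>"
    and "eigenvalue_sequence \<tau> \<mu>"
    and "\<And>j. 1 \<le> j \<Longrightarrow> is_eigenfunction \<tau> (\<mu> j) (\<phi> j)"
  shows
    "(\<tau> < tau1 \<longrightarrow>
        (\<forall>j\<ge>1. 0 < \<mu> j \<and> same_up_to_multiple (\<phi> j) (sine_form \<tau> (\<mu> j) j))) \<and>
     (\<tau> = tau1 \<longrightarrow>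
        same_up_to_multiple (\<phi> 1) (\<lambda>x. tanh tau1 - x * tanh (tau1 * x)) \<and>
        (\<forall>j\<ge>2. 0 < \<mu> j \<and> same_up_to_multiple (\<phi> j) (sine_form \<tau> (\<mu> j) j))) \<and>
     (tau1 < \<tau> \<longrightarrow>
        \<mu> 1 < 0 \<and>
        same_up_to_multiple (\<phi> 1)
          (\<lambda>x. sqrt (- \<mu> 1) * cosh (sqrt (- \<mu> 1) * x)
               - \<tau> * sinh (sqrt (- \<mu> 1) * x) * tanh (\<tau> * x)) \<and>
        (\<forall>j\<ge>2. 0 < \<mu> j \<and> same_up_to_multiple (\<phi> j) (sine_form \<tau> (\<mu> j) j)))"
proof -
  define a where a: "a = \<tau> * tanh \<tau>"
  note \<tau> = \<open>0 < \<tau>\<close>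
  have a0: "a > 0" using \<tau> a by simp
  have nth: "nth_eigenvalue a j (\<mu> j)" if "1 \<le> j" for j
    by (rule eigenvalue_sequence_nth[OF \<tau> a assms(2) that])
  have sine: "same_up_to_multiple (\<phi> j) (sine_form \<tau> (\<mu> j) j)" if "1 \<le> j" "0 < \<mu> j" for j
    by (rule eigenfunction_sine_form[OF \<tau> a nth that(2) assms(3)]) (use that in auto)
  have high: "\<forall>j\<ge>2. 0 < \<mu> j \<and> same_up_to_multiple (\<phi> j) (sine_form \<tau> (\<mu> j) j)"
    using sine nth nth_eigenvalue_pos by (metis Suc_1 Suc_leD nat.simps(3) One_nat_def
        not_less_eq_eq order_refl)
  have first: "a < 1 \<and> \<mu> 1 > 0 \<or> a = 1 \<and> \<mu> 1 = 0 \<or> a > 1 \<and> \<mu> 1 < 0"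
    using nth_eigenvalue_1_cases[OF a0 nth] by simp
  have even1: "same_up_to_multiple (\<phi> 1) (even_sol \<tau> (\<mu> 1))"
    using eigenfunction_cases[OF assms(3)[of 1]] nth_eigenvalue_even_sol[OF \<tau> a _ nth[of 1]] by simp
  show ?thesis
  proof (intro conjI impI)
    assume "\<tau> < tau1"
    then have "a < 1" using times_tanh_strict_mono[of \<tau> tau1] \<tau> tau1_props a by simp
    then have "0 < \<mu> 1" using first by auto
    show "\<forall>j\<ge>1. 0 < \<mu> j \<and> same_up_to_multiple (\<phi> j) (sine_form \<tau> (\<mu> j) j)"
    proof (intro allI impI)
      fix j :: nat assume "1 \<le> j"
      then consider "j = 1" | "2 \<le> j" by linarith
      then show "0 < \<mu> j \<and> same_up_to_multiple (\<phi> j) (sine_form \<tau> (\<mu> j) j)"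
        using high sine[of 1] \<open>0 < \<mu> 1\<close> by cases auto
    qed
  next
    assume t: "\<tau> = tau1"
    then have "a = 1" using tau1_props a by simp
    then have "\<mu> 1 = 0" using first by auto
    show "same_up_to_multiple (\<phi> 1) (\<lambda>x. tanh tau1 - x * tanh (tau1 * x))"
    proof (rule same_up_to_multiple_scale[OF even1, of "1 / \<tau>"])
      fix x
      have "tanh tau1 = 1 / \<tau>" using \<open>a = 1\<close> a \<tau> t by (simp add: field_simps)
      then show "tanh tau1 - x * tanh (tau1 * x) = 1 / \<tau> * even_sol \<tau> (\<mu> 1) x"
        using \<tau> t \<open>\<mu> 1 = 0\<close> by (simp add: even_sol_def free_sin_def free_cos_def right_diff_distrib)
    qed (use \<tau> in simp)
  next
    assume "tau1 < \<tau>"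
    then have "a > 1" using times_tanh_strict_mono[of tau1 \<tau>] tau1_props a by simp
    then show m: "\<mu> 1 < 0" using first by auto
    show "same_up_to_multiple (\<phi> 1)
          (\<lambda>x. sqrt (- \<mu> 1) * cosh (sqrt (- \<mu> 1) * x)
               - \<tau> * sinh (sqrt (- \<mu> 1) * x) * tanh (\<tau> * x))"
      by (rule same_up_to_multiple_scale[OF even1, of "sqrt (- \<mu> 1)"])
         (use m in \<open>simp_all add: even_sol_def free_sin_def free_cos_def field_simps\<close>)
  qed (use high in blast)+
qed

end
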